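(* For every positive integer $d$ and every function $f\colon\mathbb{Z}^d\to\mathbb{C}$ supported in $\{0,1\}^d$ and satisfying $\|f\|_{\ell^2(\{0,1\}^d)}=1$ one has \[ \mathrm{H}_{\mathbb{T}^d}(|\widehat{f}|^2) + \Big(\frac{1}{\ln 2}-1\Big)\, \mathrm{H}_{\mathbb{Z}^d}(|f|^2) \geq 0. \] Moreover, equality can be attained even in cases when $\mathrm{H}_{\mathbb{Z}^d}(|f|^2)\neq 0$; for example, it is attained when $f$ is constant on $\{0,1\}^d$ (and normalized so that $\|f\|_{\ell^2(\{0,1\}^d)}=1$).
   Context: $\mathbb{T}^d=(\mathbb{R}/\mathbb{Z})^d$ carries the Haar probability measure $\mathrm{d}\xi$. For finitely supported $f\colon\mathbb{Z}^d\to\mathbb{C}$, $\widehat{f}(\xi):=\sum_{x\in\mathbb{Z}^d} f(x)e^{-2\pi i x\cdot\xi}$ for $\xi\in\mathbb{T}^d$. If $\sum_x|f(x)|^2=1$, the Shannon entropies are \[ \mathrm{H}_{\mathbb{Z}^d}(|f|^2) := - \sum_{x\in\mathbb{Z}^d} |f(x)|^2 \log_2 |f(x)|^2, \qquad \mathrm{H}_{\mathbb{T}^d}(|\widehat{f}|^2) := - \int_{\mathbb{T}^d} |\widehat{f}(\xi)|^2 \log_2 |\widehat{f}(\xi)|^2 \,\mathrm{d}\xi, \] with the convention $0\log_2 0=0$. *)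

theory Defs
  imports "HOL-Probability.Probability"
begin

text \<open>Points of \<open>\<int>\<^sup>d\<close> are extensional functions on \<open>{..<d}\<close>, so that equality of points and the
  sums below only see the \<open>d\<close> coordinates.\<close>

definition int_lattice :: "nat \<Rightarrow> (nat \<Rightarrow> int) set" where
  "int_lattice d = {..<d} \<rightarrow>\<^sub>E UNIV"

definition cube :: "nat \<Rightarrow> (nat \<Rightarrow> int) set" where
  "cube d = {..<d} \<rightarrow>\<^sub>E {0, 1}"

text \<open>The torus \<open>(\<real>/\<int>)\<^sup>d\<close> is represented by its fundamental domain \<open>[0,1)\<^sup>d\<close>; its Haar probability
  measure is then the product of \<open>d\<close> copies of Lebesgue measure on \<open>[0,1)\<close>.\<close>

definition torus :: "nat \<Rightarrow> (nat \<Rightarrow> real) measure" where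
  "torus d = (\<Pi>\<^sub>M j\<in>{..<d}. restrict_space lborel {0..<1})"

definition fourier :: "nat \<Rightarrow> ((nat \<Rightarrow> int) \<Rightarrow> complex) \<Rightarrow> (nat \<Rightarrow> real) \<Rightarrow> complex" where
  "fourier d f \<xi> =
     (\<Sum>\<^sub>\<infinity>x\<in>int_lattice d. f x * exp (- 2 * of_real pi * \<i> * of_real (\<Sum>j<d. of_int (x j) * \<xi> j)))"

text \<open>Since \<^term>\<open>0 * y = (0::real)\<close> for every \<open>y\<close>, the convention \<open>0 log 0 = 0\<close> holds automatically
  in both entropies.\<close>

definition lattice_entropy :: "nat \<Rightarrow> ((nat \<Rightarrow> int) \<Rightarrow> real) \<Rightarrow> real" where
  "lattice_entropy d p = - (\<Sum>\<^sub>\<infinity>x\<in>int_lattice d. p x * log 2 (p x))"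

definition torus_entropy :: "nat \<Rightarrow> ((nat \<Rightarrow> real) \<Rightarrow> real) \<Rightarrow> real" where
  "torus_entropy d p = - (\<integral>\<xi>. p \<xi> * log 2 (p \<xi>) \<partial>torus d)"

definition supported_in_cube :: "nat \<Rightarrow> ((nat \<Rightarrow> int) \<Rightarrow> complex) \<Rightarrow> bool" where
  "supported_in_cube d f \<longleftrightarrow> (\<forall>x\<in>int_lattice d - cube d. f x = 0)"

lemma space_torus: "space (torus d) = {..<d} \<rightarrow>\<^sub>E {0..<1}"
  by (simp add: torus_def space_PiM space_restrict_space)

lemma prob_space_torus: "prob_space (torus d)"
  unfolding torus_def
  by (intro prob_space_PiM prob_spaceI)
     (simp add: space_restrict_space emeasure_restrict_space)

text \<open>Periodicity: \<^const>\<open>fourier\<close> is well defined on the quotient \<open>(\<real>/\<int>)\<^sup>d\<close>.\<close>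

lemma fourier_periodic: "fourier d f (\<lambda>j. \<xi> j + of_int (k j)) = fourier d f \<xi>"
proof -
  have "exp (- 2 * of_real pi * \<i> * of_real (\<Sum>j<d. of_int (x j) * (\<xi> j + of_int (k j))))
      = exp (- 2 * of_real pi * \<i> * of_real (\<Sum>j<d. of_int (x j) * \<xi> j))" for x :: "nat \<Rightarrow> int"
    unfolding exp_eq
    by (rule exI[of _ "- (\<Sum>j<d. x j * k j)"])
       (simp add: algebra_simps sum.distrib sum_distrib_left sum_negf)
  then show ?thesis
    by (simp add: fourier_def)
qed

end

theory Submission
  imports Defs "HOL-Complex_Analysis.Complex_Analysis" "HOL-Real_Asymp.Real_Asymp"
begin

text \<open>
  Induct on the dimension, proving the homogeneous form of the inequality for all \<open>f\<close>. With \<open>g\<^sub>0, g\<^sub>1\<close>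
  the restrictions of \<open>f\<close> to the last coordinate being \<open>0\<close> or \<open>1\<close>, freezing all but the last
  frequency reduces the integral over the last frequency to the one-dimensional inequality with
  coefficients \<open>a = \<close> the transform of \<open>g\<^sub>0\<close> and \<open>b = \<close> the transform of \<open>g\<^sub>1\<close>. The remaining term
  \<open>\<integral> \<phi>(|a|\<^sup>2 + |b|\<^sup>2)\<close>, \<open>\<phi>(x) = x ln x\<close>, is controlled by the subadditivity of the entropy of the joint
  density \<open>(|a|\<^sup>2, |b|\<^sup>2)\<close> on the torus times \<open>{0,1}\<close>, whose marginal on \<open>{0,1}\<close> is given by Parseval,
  and \<open>\<integral> \<phi>(|a|\<^sup>2)\<close>, \<open>\<integral> \<phi>(|b|\<^sup>2)\<close> by the induction hypothesis.

  In dimension one the integral of \<open>\<phi>(|a + b w|\<^sup>2)\<close> over the unit circle has a closed form by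
  Cauchy's formula, and what remains is a one-variable inequality that is tight at \<open>|a| = |b|\<close>.
  For constant \<open>f\<close> every step of the recursion is explicit.
\<close>

section \<open>The function x ln x and subadditivity of entropy\<close>

definition xlnx :: "real \<Rightarrow> real" where
  "xlnx x = x * ln x"

lemma xlnx_0 [simp]: "xlnx 0 = 0"
  by (simp add: xlnx_def)

lemma xlnx_1 [simp]: "xlnx 1 = 0"
  by (simp add: xlnx_def)

lemma xlnx_mult: "C \<ge> 0 \<Longrightarrow> x \<ge> 0 \<Longrightarrow> xlnx (C * x) = xlnx C * x + C * xlnx x"
  by (cases "C = 0 \<or> x = 0") (auto simp: xlnx_def ln_mult algebra_simps)

text \<open>Continuity up to the endpoint 0 matters because |a + b w|^2 vanishes somewhere on the
  unit circle when |a| = |b|, which is the equality case.\<close>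

lemma continuous_on_xlnx: "continuous_on {0..} xlnx"
proof -
  have "continuous (at x within {0..}) xlnx" if "x \<ge> 0" for x
  proof (cases "x = 0")
    case True
    have "((\<lambda>x::real. x * ln x) \<longlongrightarrow> 0) (at_right 0)"
      by real_asymp
    then show ?thesis
      using True by (simp add: continuous_within xlnx_def [abs_def] at_within_Ici_at_right)
  next
    case False
    then show ?thesis
      using that unfolding xlnx_def [abs_def] by (intro continuous_intros) auto
  qed
  then show ?thesis
    by (simp add: continuous_on_eq_continuous_within)
qed

lemma borel_measurable_xlnx [measurable]: "xlnx \<in> borel_measurable borel"
  unfolding xlnx_def [abs_def] by measurable

lemma has_real_derivative_xlnx [derivative_intros]:
  assumes "(f has_real_derivative D) (at x within S)" "f x > 0"
  shows "((\<lambda>x. xlnx (f x)) has_real_derivative (ln (f x) + 1) * D) (at x within S)"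
proof -
  have "((\<lambda>x. f x * ln (f x)) has_real_derivative f x * (D / f x) + D * ln (f x)) (at x within S)"
    using assms by (auto intro!: derivative_eq_intros)
  then show ?thesis
    using assms(2) by (simp add: xlnx_def [abs_def] algebra_simps)
qed

text \<open>Gibbs' inequality \<open>u ln u \<ge> u ln v + u - v\<close>, applied at \<open>v = (x + y) A / (A + B)\<close> and
  \<open>v = (x + y) B / (A + B)\<close>. Integrated against a measure with \<open>\<integral>x = A\<close> and \<open>\<integral>y = B\<close>, it becomes the
  subadditivity of entropy.\<close>

lemma xlnx_add_le_relative:
  assumes "x \<ge> 0" "y \<ge> 0" "A \<ge> 0" "B \<ge> 0" "A = 0 \<Longrightarrow> x = 0" "B = 0 \<Longrightarrow> y = 0"
  shows "xlnx (x + y) \<le> xlnx x + xlnx y - x * ln A - y * ln B + (x + y) * ln (A + B)"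
proof (cases "x = 0 \<or> y = 0")
  case True
  \<comment> \<open>Since \<open>ln 0 = 0\<close>, monotonicity of \<open>ln\<close> could fail at v
    = 0; there the hypothesis forces u = 0.\<close>
  have mono: "u * ln v \<le> u * ln (v + v')"
    if "u \<ge> 0" "v \<ge> 0" "v' \<ge> 0" "v = 0 \<Longrightarrow> u = 0" for u v v' :: real
  proof (cases "u = 0")
    case False
    then have "v > 0" using that by (auto simp: less_le)
    then show ?thesis using that by (intro mult_left_mono ln_mono) auto
  qed auto
  have "x * ln A \<le> x * ln (A + B)" "y * ln B \<le> y * ln (A + B)"
    using mono[of x A B] mono[of y B A] assms by (auto simp: add.commute)
  then show ?thesis
    using True by (auto simp: xlnx_def)
next
  case False
  then have pos: "x > 0" "y > 0" "A > 0" "B > 0"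
    using assms by (auto simp: less_le)
  have tangent: "u * ln v + u - v \<le> u * ln u" if "u > 0" "v > 0" for u v :: real
  proof -
    have "ln (v / u) \<le> v / u - 1"
      using that by (intro ln_le_minus_one) auto
    then have "u * ln (v / u) \<le> u * (v / u - 1)"
      using that by (intro mult_left_mono) auto
    then show ?thesis
      using that by (simp add: ln_div algebra_simps)
  qed
  define u v where "u = (x + y) * A / (A + B)" and "v = (x + y) * B / (A + B)"
  have "x * ln u + x - u \<le> x * ln x" "y * ln v + y - v \<le> y * ln y"
    using pos by (intro tangent; simp add: u_def v_def)+
  moreover have "u + v = x + y"
    using pos by (simp add: u_def v_def flip: add_divide_distrib distrib_left)
  moreover have "ln u = ln (x + y) + ln A - ln (A + B)" "ln v = ln (x + y) + ln B - ln (A + B)"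
    using pos by (simp_all add: u_def v_def ln_mult ln_div)
  ultimately show ?thesis
    by (simp add: xlnx_def algebra_simps)
qed

section \<open>The one-variable inequality\<close>

lemma binary_entropy_lower_bound:
  fixes p :: real
  assumes "0 < p" "p \<le> 1 / 2"
  shows "ln (1 - p) + 2 * p \<le> (1 / ln 2 - 1) * (- xlnx p - xlnx (1 - p))"
  \<comment> \<open>The difference \<open>G\<close> vanishes at \<open>0\<close> and \<open>1/2\<close>, is concave on \<open>[0, 1 - ln 2]\<close>, and is convex on
    \<open>[1 - ln 2, 1/2]\<close> with a critical point at \<open>1/2\<close>.\<close>
proof -
  define c :: real where "c = 1 / ln 2 - 1"
  define q :: real where "q = 1 - ln 2"
  define G where "G = (\<lambda>x. c * (- xlnx x - xlnx (1 - x)) - ln (1 - x) - 2 * x)"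
  define G' where "G' = (\<lambda>x::real. c * (ln (1 - x) - ln x) + 1 / (1 - x) - 2)"
  define G'' where "G'' = (\<lambda>x::real. 1 / (1 - x)\<^sup>2 - c / (x * (1 - x)))"
  have q: "0 < q" "q \<le> 1 / 2"
    using ln_2_less_1 ln2_ge_two_thirds by (auto simp: q_def)
  have dG: "(G has_real_derivative G' x) (at x)" if "0 < x" "x < 1" for x
    unfolding G_def G'_def using that
    by (auto intro!: derivative_eq_intros simp: algebra_simps)
  have dG': "(G' has_real_derivative G'' x) (at x)" if "0 < x" "x < 1" for x
    unfolding G''_def G'_def using that
    by (auto intro!: derivative_eq_intros simp: field_simps power2_eq_square)
  have G'': "G'' x = (x - q) / (ln 2 * x * (1 - x)\<^sup>2)" if "0 < x" "x < 1" for x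
  proof -
    define u where "u = 1 - x"
    have "G'' x = (ln 2 * x - (1 - ln 2) * u) / (ln 2 * x * u\<^sup>2)"
    proof -
      have "u \<noteq> 0" using that by (simp add: u_def)
      then have "1 / u\<^sup>2 - (1 / ln 2 - 1) / (x * u) = (ln 2 * x - (1 - ln 2) * u) / (ln 2 * x * u\<^sup>2)"
        using that by (simp add: divide_simps power2_eq_square)
      then show ?thesis
        by (simp add: G''_def c_def u_def)
    qed
    then show ?thesis
      by (simp add: u_def q_def algebra_simps)
  qed
  have G'_half: "G' (1 / 2) = 0"
    by (simp add: G'_def)
  \<comment> \<open>This equation, c ln 2 + ln 2 - 1 = 0, is what determines the constant c = 1 / ln
    2 - 1.\<close>
  have G_half: "G (1 / 2) = 0"
    by (simp add: G_def c_def xlnx_def ln_div field_simps)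
  have contG: "continuous_on {0..1 / 2} G"
    unfolding G_def
    by (intro continuous_intros continuous_on_compose2[OF continuous_on_xlnx]) auto
  have right: "G x \<ge> 0" if "q \<le> x" "x \<le> 1 / 2" for x
  proof -
    have "G' y \<le> 0" if "q \<le> y" "y \<le> 1 / 2" for y
    proof -
      have "G' y \<le> G' (1 / 2)"
      proof (rule DERIV_nonneg_imp_nondecreasing[OF that(2)])
        fix z assume "y \<le> z" "z \<le> 1 / 2"
        then show "\<exists>D. (G' has_real_derivative D) (at z) \<and> 0 \<le> D"
          using that q by (intro exI[of _ "G'' z"] conjI dG') (auto simp: G'')
      qed
      then show ?thesis by (simp add: G'_half)
    qed
    then have "G (1 / 2) \<le> G x"
      using that q by (intro DERIV_nonpos_imp_nonincreasing[OF that(2)]) (force intro: dG)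
    then show ?thesis by (simp add: G_half)
  qed
  \<comment> \<open>Concavity by mean values: if G p < 0, then G' is negative somewhere in (0, p),
    because G 0 = 0, and positive somewhere in (p, q), because G q is nonnegative. But G' is
    nonincreasing between these two points.\<close>
  have left: "G p \<ge> 0" if "p < q"
  proof (rule ccontr)
    assume neg: "\<not> G p \<ge> 0"
    have mvt: "\<exists>z. u < z \<and> z < v \<and> G v - G u = (v - u) * G' z" if "0 \<le> u" "u < v" "v \<le> 1 / 2" for u v
    proof -
      have "\<exists>l z. u < z \<and> z < v \<and> DERIV G z :> l \<and> G v - G u = (v - u) * l"
      proof (rule MVT[OF that(2)])
        show "continuous_on {u..v} G"
          using that by (intro continuous_on_subset[OF contG]) auto
        show "G differentiable (at x)" if "u < x" "x < v" for x
          using dG[of x] that \<open>0 \<le> u\<close> \<open>v \<le> 1 / 2\<close> by (auto simp: real_differentiable_def)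
      qed
      then obtain l z where z: "u < z" "z < v" "DERIV G z :> l" "G v - G u = (v - u) * l"
        by blast
      moreover have "l = G' z"
        using z that by (intro DERIV_unique[OF z(3) dG]) auto
      ultimately show ?thesis by blast
    qed
    obtain z where z: "p < z" "z < q" "G q - G p = (q - p) * G' z"
      using mvt[OF less_imp_le[OF assms(1)] \<open>p < q\<close> q(2)] by blast
    obtain y where y: "0 < y" "y < p" "G p - G 0 = (p - 0) * G' y"
      using mvt[OF order_refl assms] by blast
    have "G q - G p > 0"
      using right[of q] q neg by auto
    then have "G' z > 0"
      using z that by (simp add: zero_less_mult_iff)
    have "G 0 = 0"
      by (simp add: G_def xlnx_def)
    then have "G' y < 0"
      using y neg assms by (auto simp: zero_le_mult_iff)
    have "G' z \<le> G' y"
    proof (rule DERIV_nonpos_imp_nonincreasing[of y z G'])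
      fix x assume x: "y \<le> x" "x \<le> z"
      then have "0 < x" "x < 1" "x \<le> q" using y z q by auto
      then show "\<exists>D. (G' has_real_derivative D) (at x) \<and> D \<le> 0"
        by (intro exI[of _ "G'' x"] conjI dG') (auto simp: G'' divide_le_0_iff zero_le_mult_iff)
    qed (use y z in auto)
    then show False
      using \<open>G' z > 0\<close> \<open>G' y < 0\<close> by simp
  qed
  have "G p \<ge> 0"
    using left right assms by force
  then show ?thesis
    by (simp add: G_def c_def)
qed

section \<open>Integrals over the unit circle\<close>

text \<open>Cauchy's formula at 0 for f and for its derivative. On the circle dw = 2 pi i w dt,
  which cancels one power of w in f(w) / w^(k+1).\<close>

lemma has_integral_circle_mean:
  assumes "f holomorphic_on ball 0 R" "R > 1"
  shows "((\<lambda>t. f (cis (2 * pi * t))) has_integral f 0) {0..1}"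
    and "((\<lambda>t. f (cis (2 * pi * t)) / cis (2 * pi * t)) has_integral deriv f 0) {0..1}"
proof -
  have cont: "continuous_on (cball 0 1) f" and hol: "f holomorphic_on ball 0 1"
    using assms by (auto intro!: holomorphic_on_imp_continuous_on elim!: holomorphic_on_subset)
  have *: "((\<lambda>t. 2 * pi * \<i> * (f (cis (2 * pi * t)) / cis (2 * pi * t) ^ k))
             has_integral 2 * pi * \<i> * ((deriv ^^ k) f 0 / fact k)) {0..1}" for k
  proof -
    have "((\<lambda>u. f u / (u - 0) ^ Suc k) has_contour_integral ((2 * pi * \<i>) / (fact k) * (deriv ^^ k) f 0))
           (circlepath 0 1)"
      by (rule Cauchy_has_contour_integral_higher_derivative_circlepath[OF cont hol]) simp
    then have "((\<lambda>t. f (circlepath 0 1 t) / (circlepath 0 1 t - 0) ^ Suc k *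
        vector_derivative (circlepath 0 1) (at t within {0..1}))
        has_integral 2 * pi * \<i> * ((deriv ^^ k) f 0 / fact k)) {0..1}"
      by (simp add: has_contour_integral_def)
    moreover have "f (circlepath 0 1 t) / (circlepath 0 1 t - 0) ^ Suc k *
        vector_derivative (circlepath 0 1) (at t within {0..1})
        = 2 * pi * \<i> * (f (cis (2 * pi * t)) / cis (2 * pi * t) ^ k)" if "t \<in> {0..1}" for t
    proof -
      have e: "exp (2 * of_real pi * \<i> * of_real t) = cis (2 * pi * t)"
        by (simp add: cis_conv_exp algebra_simps)
      have "circlepath 0 1 t = cis (2 * pi * t)"
        by (simp add: circlepath e)
      moreover have "vector_derivative (circlepath 0 1) (at t within {0..1})
          = 2 * pi * \<i> * cis (2 * pi * t)"
        using that by (simp add: vector_derivative_circlepath01 e)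
      ultimately show ?thesis by simp
    qed
    ultimately show ?thesis
      by (subst has_integral_cong[symmetric]) auto
  qed
  have **: "((\<lambda>t. f (cis (2 * pi * t)) / cis (2 * pi * t) ^ k)
             has_integral (deriv ^^ k) f 0 / fact k) {0..1}" for k
    using has_integral_mult_right[OF *[of k], of "1 / (2 * pi * \<i>)"] by simp
  show "((\<lambda>t. f (cis (2 * pi * t))) has_integral f 0) {0..1}"
    using **[of 0] by simp
  show "((\<lambda>t. f (cis (2 * pi * t)) / cis (2 * pi * t)) has_integral deriv f 0) {0..1}"
    using **[of 1] by simp
qed

lemma cmod_add_mult_unit_sq:
  assumes "cmod w = 1"
  shows "(cmod (a + b * w))\<^sup>2 = (cmod a)\<^sup>2 + (cmod b)\<^sup>2 + 2 * Re (cnj a * b * w)"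
proof -
  have "(cmod (a + b * w))\<^sup>2 = (cmod a)\<^sup>2 + (cmod (b * w))\<^sup>2 + 2 * Re (cnj a * (b * w))"
    by (simp only: cmod_power2) (simp add: power2_eq_square algebra_simps)
  then show ?thesis
    using assms by (simp add: norm_mult mult.assoc)
qed

text \<open>The cross term is the real part of a multiple of w, so its mean is its value 0 at the
  origin.\<close>

lemma has_integral_cmod_sq_circle:
  "((\<lambda>t. (cmod (a + b * cis (2 * pi * t)))\<^sup>2) has_integral (cmod a)\<^sup>2 + (cmod b)\<^sup>2) {0..1}"
proof -
  let ?f = "\<lambda>w. of_real ((cmod a)\<^sup>2 + (cmod b)\<^sup>2) + 2 * (cnj a * b * w)"
  have "?f holomorphic_on ball 0 2"
    by (intro holomorphic_intros)
  then have "((\<lambda>t. ?f (cis (2 * pi * t))) has_integral ?f 0) {0..1}"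
    by (rule has_integral_circle_mean) simp
  from has_integral_linear[OF this bounded_linear_Re] show ?thesis
    by (simp add: o_def cmod_add_mult_unit_sq)
qed

text \<open>On the unit circle \<open>|1 + sw|\<^sup>2 = 1 + |s|\<^sup>2 + sw + cnj s / w\<close>, so the integrand is twice the real
  part of \<open>Ln (1 + sw)\<close> times this sum. The summand with \<open>1/w\<close> contributes the derivative of
  \<open>Ln (1 + sw)\<close> at \<open>0\<close>, the others contribute nothing.\<close>

lemma has_integral_xlnx_circle_less:
  assumes "cmod s < 1"
  shows "((\<lambda>t. xlnx ((cmod (1 + s * cis (2 * pi * t)))\<^sup>2)) has_integral 2 * (cmod s)\<^sup>2) {0..1}"
proof (cases "s = 0")
  case True
  then show ?thesis by (simp add: xlnx_def)
next
  case False
  let ?Q = "\<lambda>w. Ln (1 + s * w)"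
  let ?P = "\<lambda>w. Ln (1 + s * w) * (of_real (1 + (cmod s)\<^sup>2) + s * w)"
  \<comment> \<open>On the disc of this radius |s w| < 1, so 1 + s w stays in the right half-plane,
    off the branch cut of \<open>Ln\<close>.\<close>
  define R where "R = 1 / cmod s"
  have R: "R > 1" using assms False by (simp add: R_def)
  have nonpos: "1 + s * w \<notin> \<real>\<^sub>\<le>\<^sub>0" if "w \<in> ball 0 R" for w
  proof -
    have "cmod (s * w) < 1"
      using that False by (simp add: R_def norm_mult field_simps)
    then have "Re (1 + s * w) > 0"
      using abs_Re_le_cmod[of "s * w"] by simp
    then show ?thesis by (auto simp: complex_nonpos_Reals_iff)
  qed
  have holQ: "?Q holomorphic_on ball 0 R"
    using nonpos by (intro holomorphic_intros) auto
  have holP: "?P holomorphic_on ball 0 R"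
    using nonpos by (intro holomorphic_intros) auto
  have "(?Q has_field_derivative s) (at 0)"
    by (auto intro!: derivative_eq_intros)
  then have "deriv ?Q 0 = s"
    by (rule DERIV_imp_deriv)
  then have "((\<lambda>t. ?Q (cis (2 * pi * t)) / cis (2 * pi * t)) has_integral s) {0..1}"
    using has_integral_circle_mean(2)[OF holQ R] by simp
  from has_integral_add[OF has_integral_circle_mean(1)[OF holP R]
      has_integral_mult_right[OF this, of "cnj s"]]
  have "((\<lambda>t. 2 * Re (?P (cis (2 * pi * t)) + cnj s * (?Q (cis (2 * pi * t)) / cis (2 * pi * t))))
      has_integral 2 * Re (cnj s * s)) {0..1}"
    by (intro has_integral_mult_right) (drule has_integral_linear[OF _ bounded_linear_Re], simp add: o_def)
  moreover have "2 * Re (cnj s * s) = 2 * (cmod s)\<^sup>2"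
    by (simp only: cmod_power2) (simp add: power2_eq_square)
  moreover have "2 * Re (?P w + cnj s * (?Q w / w)) = xlnx ((cmod (1 + s * w))\<^sup>2)" if "cmod w = 1" for w
  proof -
    have w: "w * cnj w = 1" "w \<noteq> 0"
      using that by (auto simp flip: complex_norm_square)
    then have inv: "1 / w = cnj w" by (simp add: field_simps)
    have "1 + s * w \<noteq> 0"
      using nonpos[of w] that R by auto
    have "complex_of_real ((cmod (1 + s * w))\<^sup>2) = of_real (1 + (cmod s)\<^sup>2) + s * w + cnj s / w"
    proof -
      have "cnj s / w = cnj (s * w)"
        using inv by (metis complex_cnj_mult times_divide_eq_right mult.right_neutral)
      then have "s * w + cnj s / w = of_real (2 * Re (s * w))"
        by (simp only: complex_add_cnj)
      then show ?thesis
        using cmod_add_mult_unit_sq[OF that, of 1 s] by (simp only: add.assoc of_real_add) simp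
    qed
    then have "?P w + cnj s * (?Q w / w) = Ln (1 + s * w) * of_real ((cmod (1 + s * w))\<^sup>2)"
      by (simp add: algebra_simps)
    moreover have "Re (Ln (1 + s * w)) = ln (cmod (1 + s * w))"
      using \<open>1 + s * w \<noteq> 0\<close> by simp
    moreover have "ln ((cmod (1 + s * w))\<^sup>2) = 2 * ln (cmod (1 + s * w))"
      using \<open>1 + s * w \<noteq> 0\<close> by (simp add: ln_realpow)
    ultimately show ?thesis
      by (simp add: xlnx_def)
  qed
  ultimately show ?thesis
    by (simp only: norm_cis)
qed

text \<open>For |s| = 1 the logarithm is singular on the circle, so s is replaced by r s with r
  tending to 1. Both sides are continuous in r on [0, 1], as \<open>xlnx\<close> is continuous at 0,
  and they agree for r < 1.\<close>

lemma has_integral_xlnx_circle: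
  assumes "cmod s \<le> 1"
  shows "((\<lambda>t. xlnx ((cmod (1 + s * cis (2 * pi * t)))\<^sup>2)) has_integral 2 * (cmod s)\<^sup>2) {0..1}"
proof -
  let ?f = "\<lambda>r t. xlnx ((cmod (1 + of_real r * s * cis (2 * pi * t)))\<^sup>2)"
  let ?J = "\<lambda>r. integral (cbox 0 1) (?f r) - 2 * (r * cmod s)\<^sup>2"
  have "continuous_on {0..1} ?J"
    by (intro continuous_intros integral_continuous_on_param)
       (auto simp: split_beta intro!: continuous_intros continuous_on_compose2[OF continuous_on_xlnx])
  moreover have "?J r = 0" if "r \<in> {0..<1}" for r
  proof -
    have "cmod (of_real r * s) \<le> r * 1"
      using that assms by (auto simp: norm_mult intro: mult_left_le)
    then have "cmod (of_real r * s) < 1"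
      using that by simp
    from has_integral_xlnx_circle_less[OF this] show ?thesis
      by (simp add: norm_mult power_mult_distrib integral_unique)
  qed
  ultimately have "?J 1 = 0"
    using continuous_constant_on_closure[of "{0..<1}" ?J 0 1] by simp
  moreover have "?f 1 integrable_on {0..1}"
    by (intro integrable_continuous_real continuous_on_compose2[OF continuous_on_xlnx] continuous_intros) auto
  ultimately show ?thesis
    using integrable_integral[of "?f 1" "{0..1}"] by simp
qed

text \<open>Factor out a: |a + b w|^2 = |a|^2 |1 + s w|^2 with s = b / a, and split the product by
  \<open>xlnx_mult\<close>.\<close>

lemma has_integral_xlnx_cmod_sq_circle:
  assumes "cmod b \<le> cmod a"
  shows "((\<lambda>t. xlnx ((cmod (a + b * cis (2 * pi * t)))\<^sup>2)) has_integral
           ((cmod a)\<^sup>2 + (cmod b)\<^sup>2) * ln ((cmod a)\<^sup>2) + 2 * (cmod b)\<^sup>2) {0..1}"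
proof (cases "a = 0")
  case True
  then show ?thesis using assms by simp
next
  case False
  define s where "s = b / a"
  have b: "b = a * s" using False by (simp add: s_def)
  have "cmod s \<le> 1"
    using assms False by (simp add: s_def norm_divide)
  note has_integral_add[OF has_integral_mult_right[OF has_integral_cmod_sq_circle, of "xlnx ((cmod a)\<^sup>2)" 1 s]
      has_integral_mult_right[OF has_integral_xlnx_circle[OF this], of "(cmod a)\<^sup>2"]]
  moreover have "a + b * w = a * (1 + s * w)" for w
    by (simp add: b algebra_simps)
  ultimately have "((\<lambda>t. xlnx ((cmod (a + b * cis (2 * pi * t)))\<^sup>2)) has_integral
      xlnx ((cmod a)\<^sup>2) * ((cmod 1)\<^sup>2 + (cmod s)\<^sup>2) + (cmod a)\<^sup>2 * (2 * (cmod s)\<^sup>2)) {0..1}"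
    by (simp add: norm_mult power_mult_distrib xlnx_mult)
  then show ?thesis
    by (simp add: b norm_mult power_mult_distrib xlnx_def algebra_simps)
qed

section \<open>The inequality in dimension one\<close>

text \<open>\<open>binary_entropy_lower_bound\<close> at p = B / (A + B), scaled by A + B. The left
  side is the circle integral for A = |a|^2 and B = |b|^2.\<close>

lemma two_point_entropy_bound:
  fixes A B :: real
  assumes "0 < A" "0 \<le> B" "B \<le> A"
  shows "(A + B) * ln A + 2 * B \<le> 1 / ln 2 * xlnx (A + B) - (1 / ln 2 - 1) * (xlnx A + xlnx B)"
proof (cases "B = 0")
  case True
  then show ?thesis by (simp add: xlnx_def algebra_simps)
next
  case False
  define S p where "S = A + B" and "p = B / S"
  have S: "S > 0" and p: "0 < p" "p \<le> 1 / 2" and AB: "B = S * p" "A = S * (1 - p)"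
    using assms False by (auto simp: S_def p_def field_simps)
  have "S * (ln (1 - p) + 2 * p) \<le> S * ((1 / ln 2 - 1) * (- xlnx p - xlnx (1 - p)))"
    using binary_entropy_lower_bound[OF p] S by (intro mult_left_mono) auto
  moreover have "xlnx A + xlnx B = xlnx S + S * (xlnx p + xlnx (1 - p))"
    unfolding AB using S p by (subst (1 2) xlnx_mult) (auto simp: algebra_simps)
  moreover have "ln A = ln S + ln (1 - p)"
    unfolding AB using S p by (subst ln_mult) auto
  ultimately show ?thesis
    unfolding S_def[symmetric] by (simp add: AB(1) xlnx_def[of S] algebra_simps)
qed

lemma integral_xlnx_circle_le:
  "integral {0..1} (\<lambda>t. xlnx ((cmod (a + b * cis (2 * pi * t)))\<^sup>2))
     \<le> 1 / ln 2 * xlnx ((cmod a)\<^sup>2 + (cmod b)\<^sup>2)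
        - (1 / ln 2 - 1) * (xlnx ((cmod a)\<^sup>2) + xlnx ((cmod b)\<^sup>2))"
  (is "?P a b")
proof -
  have *: "?P a b" if "cmod b \<le> cmod a" for a b
  proof (cases "a = 0")
    case False
    have "(cmod b)\<^sup>2 \<le> (cmod a)\<^sup>2"
      using that by (intro power_mono) auto
    then show ?thesis
      using has_integral_xlnx_cmod_sq_circle[OF that] False two_point_entropy_bound[of "(cmod a)\<^sup>2" "(cmod b)\<^sup>2"]
      by (simp add: integral_unique)
  qed (use that in auto)
  \<comment> \<open>Conjugating and multiplying by the unit \<open>cis t\<close> exchanges the roles
    of a and b, so |b| may be taken to be at most |a|.\<close>
  have "cmod (a + b * cis t) = cmod (cnj b + cnj a * cis t)" for t
  proof -
    have "cnj (a + b * cis t) * cis t = cnj b + cnj a * cis t"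
      by (simp add: cis_cnj algebra_simps cis_mult)
    moreover have "cmod (cnj (a + b * cis t) * cis t) = cmod (a + b * cis t)"
      by (simp only: norm_mult norm_cis complex_mod_cnj mult_1_right)
    ultimately show ?thesis by simp
  qed
  then show ?thesis
    using *[of b a] *[of "cnj a" "cnj b"] by (cases "cmod b \<le> cmod a") (simp_all add: add.commute)
qed

section \<open>Trigonometric polynomials on the torus\<close>

definition circle :: "real measure" where
  "circle = restrict_space lborel {0..<1}"

text \<open>Only the values of g on the cube enter, so the induction can run over arbitrary g with
  no condition on the support.\<close>

definition trig_poly :: "nat \<Rightarrow> ((nat \<Rightarrow> int) \<Rightarrow> complex) \<Rightarrow> (nat \<Rightarrow> real) \<Rightarrow> complex" where
  "trig_poly d g \<xi> = (\<Sum>x\<in>cube d. g x * cis (- 2 * pi * (\<Sum>j<d. of_int (x j) * \<xi> j)))"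

lemma finite_cube [simp]: "finite (cube d)"
  by (simp add: cube_def finite_PiE)

lemma cube_0 [simp]: "cube 0 = {\<lambda>_. undefined}"
  by (simp add: cube_def)

lemma card_cube: "card (cube d) = 2 ^ d"
  by (simp add: cube_def card_PiE numeral_2_eq_2)

lemma sum_cube_Suc: "sum h (cube (Suc d)) = (\<Sum>x\<in>cube d. h (x(d := 0))) + (\<Sum>x\<in>cube d. h (x(d := 1)))"
proof -
  have "cube (Suc d) = (\<lambda>x. x(d := 0)) ` cube d \<union> (\<lambda>x. x(d := 1)) ` cube d"
    unfolding cube_def lessThan_Suc PiE_insert_eq by auto
  moreover have "(\<lambda>x. x(d := 0)) ` cube d \<inter> (\<lambda>x. x(d := 1)) ` cube d = {}"
    by (auto dest: fun_cong[of _ _ d])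
  moreover have "inj_on (\<lambda>x. x(d := c)) (cube d)" for c
  proof (rule inj_onI)
    \<comment> \<open>Points of \<open>cube d\<close> are \<open>undefined\<close> at index d, so
      overwriting that value loses no information.\<close>
    fix x y assume xy: "x \<in> cube d" "y \<in> cube d" "x(d := c) = y(d := c)"
    then have "x d = y d"
      by (auto simp: cube_def PiE_def extensional_def)
    with xy(3) show "x = y"
      by (metis fun_upd_triv fun_upd_upd)
  qed
  ultimately show ?thesis
    by (simp add: sum.union_disjoint sum.reindex o_def)
qed

text \<open>With the first d frequencies frozen, the polynomial has the form a + b w with w on the
  unit circle.\<close>

lemma trig_poly_Suc:
  "trig_poly (Suc d) g (\<xi>(d := t)) =
     trig_poly d (\<lambda>x. g (x(d := 0))) \<xi> + trig_poly d (\<lambda>x. g (x(d := 1))) \<xi> * cis (- 2 * pi * t)"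
proof -
  have "cis (- 2 * pi * (s + t)) = cis (- 2 * pi * s) * cis (- 2 * pi * t)" for s
    by (simp add: cis_mult algebra_simps)
  then show ?thesis
    unfolding trig_poly_def sum_cube_Suc by (simp add: sum_distrib_right mult.assoc)
qed

lemma torus_eq: "torus d = Pi\<^sub>M {..<d} (\<lambda>_. circle)"
  by (simp add: torus_def circle_def)

lemma prob_space_circle: "prob_space circle"
  unfolding circle_def
  by (intro prob_spaceI) (simp add: space_restrict_space emeasure_restrict_space)

lemma integral_circle:
  fixes f :: "real \<Rightarrow> real"
  assumes "continuous_on {0..1} f"
  shows "integral\<^sup>L circle f = integral {0..1} f"
proof -
  have "set_integrable lborel {0..1} f"
    by (rule borel_integrable_atLeastAtMost') fact
  then have "set_integrable lborel {0..<1} f"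
    by (rule set_integrable_subset) auto
  then have "integral\<^sup>L circle f = integral {0..<1} f"
    using set_borel_integral_eq_integral(2)[of "{0..<1}" f]
    by (simp add: circle_def integral_restrict_space set_lebesgue_integral_def)
  also have "\<dots> = integral {0..1} f"
    by (rule integral_spike_set) (auto intro: negligible_subset[of "{1}"])
  finally show ?thesis .
qed

lemma borel_measurable_circle_ident [measurable]: "(\<lambda>x. x) \<in> borel_measurable circle"
  unfolding circle_def by (rule measurable_restrict_space1) simp

lemma trig_poly_measurable [measurable]: "trig_poly d g \<in> borel_measurable (torus d)"
proof -
  have [measurable]: "(\<lambda>\<xi>. \<xi> j) \<in> borel_measurable (torus d)" if "j < d" for j
    unfolding torus_eq
    by (rule measurable_compose[of "\<lambda>\<xi>. \<xi> j" _ circle]) (use that in \<open>auto intro: borel_measurable_circle_ident\<close>)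
  show ?thesis
    unfolding trig_poly_def [abs_def] cis_conv_exp by measurable
qed

lemma cmod_trig_poly_le: "cmod (trig_poly d g \<xi>) \<le> (\<Sum>x\<in>cube d. cmod (g x))"
  unfolding trig_poly_def by (rule sum_norm_le) (simp add: norm_mult)

text \<open>The argument of h stays in a compact interval, so the integrand is bounded on a
  probability space. The choice g' = 0 covers a single polynomial.\<close>

lemma integrable_trig_poly:
  fixes h :: "real \<Rightarrow> real"
  assumes cont: "continuous_on {0..} h" and [measurable]: "h \<in> borel_measurable borel"
  shows "integrable (torus d) (\<lambda>\<xi>. h ((cmod (trig_poly d g \<xi>))\<^sup>2 + (cmod (trig_poly d g' \<xi>))\<^sup>2))"
proof -
  interpret prob_space "torus d" by (rule prob_space_torus)
  define b where "b = (\<Sum>x\<in>cube d. cmod (g x))\<^sup>2 + (\<Sum>x\<in>cube d. cmod (g' x))\<^sup>2"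
  have "compact (h ` {0..b})"
    by (intro compact_continuous_image continuous_on_subset[OF cont]) auto
  then obtain B where B: "\<forall>y\<in>h ` {0..b}. norm y \<le> B"
    using compact_imp_bounded bounded_iff by metis
  show ?thesis
  proof (rule integrable_const_bound[of _ B])
    have "(cmod (trig_poly d g \<xi>))\<^sup>2 + (cmod (trig_poly d g' \<xi>))\<^sup>2 \<in> {0..b}" for \<xi>
      by (auto simp: b_def intro!: add_mono power_mono cmod_trig_poly_le)
    then show "AE \<xi> in torus d. norm (h ((cmod (trig_poly d g \<xi>))\<^sup>2 + (cmod (trig_poly d g' \<xi>))\<^sup>2)) \<le> B"
      using B by blast
  qed measurable
qed

text \<open>Fubini in the last frequency. The conjugates turn \<open>cis (- 2 * pi * t)\<close> into
  \<open>cis (2 * pi * t)\<close>, the form of the circle integrals above.\<close>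

lemma integral_torus_Suc:
  fixes h :: "real \<Rightarrow> real"
  assumes cont: "continuous_on {0..} h" and meas: "h \<in> borel_measurable borel"
  shows "(\<integral>\<xi>. h ((cmod (trig_poly (Suc d) g \<xi>))\<^sup>2) \<partial>torus (Suc d)) =
    (\<integral>\<xi>. integral {0..1} (\<lambda>t. h ((cmod (cnj (trig_poly d (\<lambda>x. g (x(d := 0))) \<xi>)
             + cnj (trig_poly d (\<lambda>x. g (x(d := 1))) \<xi>) * cis (2 * pi * t)))\<^sup>2)) \<partial>torus d)"
proof -
  interpret circle: prob_space circle by (rule prob_space_circle)
  interpret product_sigma_finite "\<lambda>_::nat. circle" ..
  have "integrable (torus (Suc d)) (\<lambda>\<xi>. h ((cmod (trig_poly (Suc d) g \<xi>))\<^sup>2))"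
    using integrable_trig_poly[OF cont meas, of "Suc d" g "\<lambda>_. 0"] by (simp add: trig_poly_def)
  then have "(\<integral>\<xi>. h ((cmod (trig_poly (Suc d) g \<xi>))\<^sup>2) \<partial>torus (Suc d)) =
      (\<integral>\<xi>. (\<integral>t. h ((cmod (trig_poly (Suc d) g (\<xi>(d := t))))\<^sup>2) \<partial>circle) \<partial>torus d)"
    unfolding torus_eq lessThan_Suc by (intro product_integral_insert) auto
  moreover have "cmod (trig_poly (Suc d) g (\<xi>(d := t))) = cmod (cnj (trig_poly d (\<lambda>x. g (x(d := 0))) \<xi>)
             + cnj (trig_poly d (\<lambda>x. g (x(d := 1))) \<xi>) * cis (2 * pi * t))" for \<xi> t
    by (subst complex_mod_cnj[symmetric]) (simp add: trig_poly_Suc cis_cnj)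
  moreover have "continuous_on {0..1} (\<lambda>t. h ((cmod (a + b * cis (2 * pi * t)))\<^sup>2))" for a b
    by (intro continuous_on_compose2[OF cont] continuous_intros) auto
  ultimately show ?thesis
    by (simp add: integral_circle)
qed

text \<open>Monotonicity of the integral in the induction step needs this. Fubini on the product of
  torus and circle also gives measurability of the inner integral.\<close>

lemma integrable_integral_trig_poly:
  fixes h :: "real \<Rightarrow> real"
  assumes cont: "continuous_on {0..} h" and [measurable]: "h \<in> borel_measurable borel"
  shows "integrable (torus d) (\<lambda>\<xi>. integral {0..1} (\<lambda>t. h ((cmod (cnj (trig_poly d g \<xi>)
             + cnj (trig_poly d g' \<xi>) * cis (2 * pi * t)))\<^sup>2)))"
proof -
  interpret torus: prob_space "torus d" by (rule prob_space_torus)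
  interpret circle: prob_space circle by (rule prob_space_circle)
  interpret pair_prob_space "torus d" circle ..
  define F where "F = (\<lambda>(\<xi>, t). (cmod (cnj (trig_poly d g \<xi>) + cnj (trig_poly d g' \<xi>) * cis (2 * pi * t)))\<^sup>2)"
  have [measurable]: "snd \<in> borel_measurable (torus d \<Otimes>\<^sub>M circle)"
    by (rule measurable_compose[OF measurable_snd borel_measurable_circle_ident])
  have [measurable]: "cnj \<in> borel_measurable borel"
    by (intro borel_measurable_continuous_onI continuous_intros)
  have [measurable]: "F \<in> borel_measurable (torus d \<Otimes>\<^sub>M circle)"
    unfolding F_def split_beta cis_conv_exp by measurable
  define b where "b = ((\<Sum>x\<in>cube d. cmod (g x)) + (\<Sum>x\<in>cube d. cmod (g' x)))\<^sup>2"
  have F: "F z \<in> {0..b}" for z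
    unfolding F_def b_def
    by (auto simp: split_beta norm_mult intro!: power_mono norm_triangle_le add_mono cmod_trig_poly_le)
  have "compact (h ` {0..b})"
    by (intro compact_continuous_image continuous_on_subset[OF cont]) auto
  then obtain B where B: "\<forall>y\<in>h ` {0..b}. norm y \<le> B"
    using compact_imp_bounded bounded_iff by metis
  have "integrable (torus d \<Otimes>\<^sub>M circle) (\<lambda>z. h (F z))"
    by (rule P.integrable_const_bound[of _ B]) (use F B in \<open>auto intro!: AE_I2\<close>)
  then have "integrable (torus d) (\<lambda>\<xi>. \<integral>t. h (F (\<xi>, t)) \<partial>circle)"
    by (rule integrable_fst')
  moreover have "(\<integral>t. h (F (\<xi>, t)) \<partial>circle) = integral {0..1} (\<lambda>t. h (F (\<xi>, t)))" for \<xi>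
    unfolding F_def by (auto intro!: integral_circle continuous_on_compose2[OF cont] continuous_intros)
  ultimately show ?thesis
    by (simp add: F_def)
qed

section \<open>Parseval and the induction on the dimension\<close>

lemma parseval_trig_poly: "(\<integral>\<xi>. (cmod (trig_poly d g \<xi>))\<^sup>2 \<partial>torus d) = (\<Sum>x\<in>cube d. (cmod (g x))\<^sup>2)"
proof (induction d arbitrary: g)
  case 0
  interpret prob_space "torus 0" by (rule prob_space_torus)
  show ?case by (simp add: trig_poly_def prob_space)
next
  case (Suc d)
  have int: "integrable (torus d) (\<lambda>\<xi>. (cmod (trig_poly d g \<xi>))\<^sup>2)" for g
    using integrable_trig_poly[of "\<lambda>x. x" d g "\<lambda>_. 0"] by (simp add: trig_poly_def)
  have "(\<integral>\<xi>. (cmod (trig_poly (Suc d) g \<xi>))\<^sup>2 \<partial>torus (Suc d)) =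
      (\<integral>\<xi>. (cmod (trig_poly d (\<lambda>x. g (x(d := 0))) \<xi>))\<^sup>2 + (cmod (trig_poly d (\<lambda>x. g (x(d := 1))) \<xi>))\<^sup>2 \<partial>torus d)"
    using integral_torus_Suc[of "\<lambda>x. x" d g]
    by (simp add: integral_unique[OF has_integral_cmod_sq_circle])
  then show ?case
    by (simp add: int Suc.IH sum_cube_Suc)
qed

text \<open>Supplies the degenerate hypotheses of \<open>xlnx_add_le_relative\<close> at every point
  of the torus.\<close>

lemma trig_poly_eq_0: "(\<Sum>x\<in>cube d. (cmod (g x))\<^sup>2) = 0 \<Longrightarrow> trig_poly d g \<xi> = 0"
  by (simp add: trig_poly_def sum_nonneg_eq_0_iff)

text \<open>The term with \<open>xlnx\<close> of the total mass makes the statement homogeneous, so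
  that it applies to the two restrictions of g, which have masses A and B.\<close>

lemma integral_xlnx_trig_poly_le:
  "(\<integral>\<xi>. xlnx ((cmod (trig_poly d g \<xi>))\<^sup>2) \<partial>torus d)
     \<le> 1 / ln 2 * xlnx (\<Sum>x\<in>cube d. (cmod (g x))\<^sup>2)
        - (1 / ln 2 - 1) * (\<Sum>x\<in>cube d. xlnx ((cmod (g x))\<^sup>2))"
proof (induction d arbitrary: g)
  case 0
  interpret prob_space "torus 0" by (rule prob_space_torus)
  show ?case by (simp add: trig_poly_def norm_mult prob_space algebra_simps)
next
  case (Suc d)
  define c :: real where "c = 1 / ln 2 - 1"
  have c: "c \<ge> 0" "1 / ln 2 = 1 + c"
    using ln_2_less_1 by (auto simp: c_def)
  define g0 g1 where "g0 = (\<lambda>x. g (x(d := 0)))" and "g1 = (\<lambda>x. g (x(d := 1)))"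
  define u v where "u \<xi> = (cmod (trig_poly d g0 \<xi>))\<^sup>2" and "v \<xi> = (cmod (trig_poly d g1 \<xi>))\<^sup>2" for \<xi>
  define A B where "A = (\<Sum>x\<in>cube d. (cmod (g0 x))\<^sup>2)" and "B = (\<Sum>x\<in>cube d. (cmod (g1 x))\<^sup>2)"
  have int: "integrable (torus d) u" "integrable (torus d) v"
    using integrable_trig_poly[of "\<lambda>x. x" d _ "\<lambda>_. 0"] by (simp_all add: trig_poly_def u_def [abs_def] v_def [abs_def])
  have intx: "integrable (torus d) (\<lambda>\<xi>. xlnx (u \<xi>))" "integrable (torus d) (\<lambda>\<xi>. xlnx (v \<xi>))"
    using integrable_trig_poly[OF continuous_on_xlnx, of d _ "\<lambda>_. 0"] by (simp_all add: trig_poly_def u_def v_def)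
  have nonneg: "u \<xi> \<ge> 0" "v \<xi> \<ge> 0" "A \<ge> 0" "B \<ge> 0" for \<xi>
    by (auto simp: u_def v_def A_def B_def intro: sum_nonneg)
  have zero: "A = 0 \<Longrightarrow> u \<xi> = 0" "B = 0 \<Longrightarrow> v \<xi> = 0" for \<xi>
    using trig_poly_eq_0 by (auto simp: A_def B_def u_def v_def)
  have norm: "integral\<^sup>L (torus d) u = A" "integral\<^sup>L (torus d) v = B"
    unfolding u_def v_def A_def B_def by (rule parseval_trig_poly)+
  \<comment> \<open>Subadditivity is applied with weight 1 + c and the one-dimensional bound
    subtracts weight c, so exactly one copy of \<open>xlnx (u \<xi>) + xlnx (v \<xi>)\<close>
    remains for the induction hypothesis.\<close>
  have bnd: "integral {0..1} (\<lambda>t. xlnx ((cmod (cnj (trig_poly d g0 \<xi>)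
             + cnj (trig_poly d g1 \<xi>) * cis (2 * pi * t)))\<^sup>2)) \<le> xlnx (u \<xi>) + xlnx (v \<xi>)
         + (1 + c) * (- u \<xi> * ln A - v \<xi> * ln B + (u \<xi> + v \<xi>) * ln (A + B))" (is "?I \<xi> \<le> ?R \<xi>") for \<xi>
  proof -
    have "?I \<xi> \<le> (1 + c) * xlnx (u \<xi> + v \<xi>) - c * (xlnx (u \<xi>) + xlnx (v \<xi>))"
      using integral_xlnx_circle_le[of "cnj (trig_poly d g0 \<xi>)" "cnj (trig_poly d g1 \<xi>)"]
      unfolding u_def v_def c_def by simp
    also have "\<dots> \<le> (1 + c) * (xlnx (u \<xi>) + xlnx (v \<xi>) - u \<xi> * ln A - v \<xi> * ln B + (u \<xi> + v \<xi>) * ln (A + B))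
        - c * (xlnx (u \<xi>) + xlnx (v \<xi>))"
      using c by (intro diff_right_mono mult_left_mono xlnx_add_le_relative nonneg zero) auto
    finally show ?thesis by (simp add: algebra_simps)
  qed
  have intR: "integrable (torus d) ?R"
    using int intx by (intro Bochner_Integration.integrable_add integrable_mult_right
        Bochner_Integration.integrable_diff integrable_mult_left) auto
  have "(\<integral>\<xi>. xlnx ((cmod (trig_poly (Suc d) g \<xi>))\<^sup>2) \<partial>torus (Suc d)) = integral\<^sup>L (torus d) ?I"
    unfolding g0_def g1_def by (rule integral_torus_Suc[OF continuous_on_xlnx borel_measurable_xlnx])
  also have "\<dots> \<le> integral\<^sup>L (torus d) ?R"
    by (intro integral_mono integrable_integral_trig_poly continuous_on_xlnx borel_measurable_xlnx intR bnd)
  \<comment> \<open>By Parseval u and v integrate to A and B, which turns the linear terms into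
    values of \<open>xlnx\<close>. The terms in A and B alone cancel against the induction
    hypothesis.\<close>
  also have "\<dots> = (\<integral>\<xi>. xlnx (u \<xi>) \<partial>torus d) + (\<integral>\<xi>. xlnx (v \<xi>) \<partial>torus d)
      + (1 + c) * (xlnx (A + B) - xlnx A - xlnx B)"
    using int intx by (simp add: norm xlnx_def algebra_simps)
  also have "\<dots> \<le> ((1 + c) * xlnx A - c * (\<Sum>x\<in>cube d. xlnx ((cmod (g0 x))\<^sup>2)))
      + ((1 + c) * xlnx B - c * (\<Sum>x\<in>cube d. xlnx ((cmod (g1 x))\<^sup>2)))
      + (1 + c) * (xlnx (A + B) - xlnx A - xlnx B)"
    using Suc.IH[of g0] Suc.IH[of g1] unfolding u_def v_def A_def B_def c_def
    by (intro add_mono) simp_all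
  finally show ?case
    unfolding c(2) c_def[symmetric] sum_cube_Suc
    by (simp add: A_def B_def g0_def g1_def algebra_simps)
qed

text \<open>Both restrictions of a constant are the same constant, and at a = b the circle integral
  is explicit. With Parseval the integrals satisfy I(d+1) = 2 I(d) + 2^(d+1) |k|^2.\<close>

lemma integral_xlnx_trig_poly_const:
  "(\<integral>\<xi>. xlnx ((cmod (trig_poly d (\<lambda>_. k) \<xi>))\<^sup>2) \<partial>torus d)
     = 2 ^ d * ((cmod k)\<^sup>2 * (ln ((cmod k)\<^sup>2) + real d))"
proof (induction d)
  case 0
  interpret prob_space "torus 0" by (rule prob_space_torus)
  show ?case by (simp add: trig_poly_def norm_mult prob_space xlnx_def)
next
  case (Suc d)
  let ?u = "\<lambda>\<xi>. (cmod (trig_poly d (\<lambda>_. k) \<xi>))\<^sup>2"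
  have "integrable (torus d) ?u" "integrable (torus d) (\<lambda>\<xi>. xlnx (?u \<xi>))"
    using integrable_trig_poly[of "\<lambda>x. x" d "\<lambda>_. k" "\<lambda>_. 0"]
      integrable_trig_poly[OF continuous_on_xlnx, of d "\<lambda>_. k" "\<lambda>_. 0"] by (simp_all add: trig_poly_def)
  moreover have "integral {0..1} (\<lambda>t. xlnx ((cmod (a + a * cis (2 * pi * t)))\<^sup>2))
      = 2 * xlnx ((cmod a)\<^sup>2) + 2 * (cmod a)\<^sup>2" for a
    using integral_unique[OF has_integral_xlnx_cmod_sq_circle[of a a]] by (simp add: xlnx_def)
  ultimately show ?case
    by (simp add: integral_torus_Suc[OF continuous_on_xlnx borel_measurable_xlnx] Suc.IH
        parseval_trig_poly card_cube algebra_simps)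
qed

section \<open>Entropies and the equality case\<close>

lemma cube_subset_int_lattice: "cube d \<subseteq> int_lattice d"
  by (auto simp: cube_def int_lattice_def)

lemma fourier_eq_trig_poly:
  assumes "supported_in_cube d f"
  shows "fourier d f = trig_poly d f"
proof
  fix \<xi>
  have "fourier d f \<xi> =
     (\<Sum>\<^sub>\<infinity>x\<in>cube d. f x * exp (- 2 * of_real pi * \<i> * of_real (\<Sum>j<d. of_int (x j) * \<xi> j)))"
    unfolding fourier_def using assms cube_subset_int_lattice[of d]
    by (intro infsum_cong_neutral) (auto simp: supported_in_cube_def)
  then show "fourier d f \<xi> = trig_poly d f \<xi>"
    by (simp add: trig_poly_def cis_conv_exp mult_ac)
qed

lemma lattice_entropy_eq:
  assumes "supported_in_cube d f"
  shows "lattice_entropy d (\<lambda>x. (cmod (f x))\<^sup>2) = - (\<Sum>x\<in>cube d. xlnx ((cmod (f x))\<^sup>2)) / ln 2"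
proof -
  have "(\<Sum>\<^sub>\<infinity>x\<in>int_lattice d. (cmod (f x))\<^sup>2 * log 2 ((cmod (f x))\<^sup>2))
      = (\<Sum>\<^sub>\<infinity>x\<in>cube d. (cmod (f x))\<^sup>2 * log 2 ((cmod (f x))\<^sup>2))"
    using assms cube_subset_int_lattice[of d]
    by (intro infsum_cong_neutral) (auto simp: supported_in_cube_def)
  then show ?thesis
    by (simp add: lattice_entropy_def xlnx_def log_def sum_divide_distrib)
qed

lemma torus_entropy_eq:
  assumes "supported_in_cube d f"
  shows "torus_entropy d (\<lambda>\<xi>. (cmod (fourier d f \<xi>))\<^sup>2)
    = - (\<integral>\<xi>. xlnx ((cmod (trig_poly d f \<xi>))\<^sup>2) \<partial>torus d) / ln 2"
  by (simp add: torus_entropy_def fourier_eq_trig_poly[OF assms] xlnx_def log_def)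

lemma L2_set_eq_1_iff: "L2_set g S = 1 \<longleftrightarrow> (\<Sum>x\<in>S. (g x)\<^sup>2) = 1"
  by (simp add: L2_set_def)

text \<open>For mass 1 the term \<open>xlnx 1\<close> vanishes; division by ln 2 passes to base
  2.\<close>

lemma entropy_sum_nonneg:
  assumes "supported_in_cube d f" "L2_set (\<lambda>x. cmod (f x)) (cube d) = 1"
  shows "torus_entropy d (\<lambda>\<xi>. (cmod (fourier d f \<xi>))\<^sup>2)
          + (1 / ln 2 - 1) * lattice_entropy d (\<lambda>x. (cmod (f x))\<^sup>2) \<ge> 0"
proof -
  define c :: real where "c = 1 / ln 2 - 1"
  let ?I = "\<integral>\<xi>. xlnx ((cmod (trig_poly d f \<xi>))\<^sup>2) \<partial>torus d" and ?S = "\<Sum>x\<in>cube d. xlnx ((cmod (f x))\<^sup>2)"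
  have "?I \<le> - c * ?S"
    using integral_xlnx_trig_poly_le[of d f, folded c_def] assms(2) by (simp add: L2_set_eq_1_iff)
  then have "0 \<le> (- ?I - c * ?S) / ln 2"
    by simp
  then show ?thesis
    unfolding torus_entropy_eq[OF assms(1)] lattice_entropy_eq[OF assms(1)] c_def[symmetric]
    by (simp add: diff_divide_distrib)
qed

text \<open>Normalization forces |k|^2 = 2^(-d), the uniform distribution on 2^d points. The torus
  integral of \<open>xlnx\<close> is then d (1 - ln 2).\<close>

lemma entropy_const:
  assumes "supported_in_cube d f" "L2_set (\<lambda>x. cmod (f x)) (cube d) = 1" "\<forall>x\<in>cube d. f x = k"
  shows "lattice_entropy d (\<lambda>x. (cmod (f x))\<^sup>2) = real d"
    and "torus_entropy d (\<lambda>\<xi>. (cmod (fourier d f \<xi>))\<^sup>2) = - (1 / ln 2 - 1) * real d"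
proof -
  have "2 ^ d * (cmod k)\<^sup>2 = 1"
    using assms(2,3) by (simp add: L2_set_eq_1_iff card_cube)
  then have k: "(cmod k)\<^sup>2 = 1 / 2 ^ d"
    by (simp add: field_simps)
  have ln: "ln (1 / 2 ^ d :: real) = - real d * ln 2"
    by (simp add: ln_div ln_realpow)
  show "lattice_entropy d (\<lambda>x. (cmod (f x))\<^sup>2) = real d"
    using assms(3) by (simp add: lattice_entropy_eq[OF assms(1)] k card_cube xlnx_def ln)
  have "trig_poly d f = trig_poly d (\<lambda>_. k)"
    using assms(3) by (simp add: trig_poly_def fun_eq_iff)
  then show "torus_entropy d (\<lambda>\<xi>. (cmod (fourier d f \<xi>))\<^sup>2) = - (1 / ln 2 - 1) * real d"
    by (simp add: torus_entropy_eq[OF assms(1)] integral_xlnx_trig_poly_const k ln field_simps)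
qed

theorem corollary5:
  fixes d :: nat
  assumes "d > 0"
  shows
    "(\<forall>f. supported_in_cube d f \<and> L2_set (\<lambda>x. cmod (f x)) (cube d) = 1 \<longrightarrow>
        torus_entropy d (\<lambda>\<xi>. (cmod (fourier d f \<xi>))\<^sup>2)
          + (1 / ln 2 - 1) * lattice_entropy d (\<lambda>x. (cmod (f x))\<^sup>2) \<ge> 0) \<and>
     (\<exists>f. supported_in_cube d f \<and> L2_set (\<lambda>x. cmod (f x)) (cube d) = 1 \<and>
        lattice_entropy d (\<lambda>x. (cmod (f x))\<^sup>2) \<noteq> 0 \<and>
        torus_entropy d (\<lambda>\<xi>. (cmod (fourier d f \<xi>))\<^sup>2)
          + (1 / ln 2 - 1) * lattice_entropy d (\<lambda>x. (cmod (f x))\<^sup>2) = 0) \<and>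
     (\<forall>f. supported_in_cube d f \<and> L2_set (\<lambda>x. cmod (f x)) (cube d) = 1 \<and>
        (\<exists>c. \<forall>x\<in>cube d. f x = c) \<longrightarrow>
        lattice_entropy d (\<lambda>x. (cmod (f x))\<^sup>2) \<noteq> 0 \<and>
        torus_entropy d (\<lambda>\<xi>. (cmod (fourier d f \<xi>))\<^sup>2)
          + (1 / ln 2 - 1) * lattice_entropy d (\<lambda>x. (cmod (f x))\<^sup>2) = 0)"
proof (intro conjI allI impI)
  fix f assume "supported_in_cube d f \<and> L2_set (\<lambda>x. cmod (f x)) (cube d) = 1"
  then show "torus_entropy d (\<lambda>\<xi>. (cmod (fourier d f \<xi>))\<^sup>2)
          + (1 / ln 2 - 1) * lattice_entropy d (\<lambda>x. (cmod (f x))\<^sup>2) \<ge> 0"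
    using entropy_sum_nonneg by blast
next
  define f :: "(nat \<Rightarrow> int) \<Rightarrow> complex"
    where "f x = (if x \<in> cube d then of_real (sqrt (1 / 2 ^ d)) else 0)" for x
  have f: "supported_in_cube d f" "L2_set (\<lambda>x. cmod (f x)) (cube d) = 1"
      "\<forall>x\<in>cube d. f x = of_real (sqrt (1 / 2 ^ d))"
    by (auto simp: f_def supported_in_cube_def L2_set_eq_1_iff card_cube power_divide)
  show "\<exists>f. supported_in_cube d f \<and> L2_set (\<lambda>x. cmod (f x)) (cube d) = 1 \<and>
        lattice_entropy d (\<lambda>x. (cmod (f x))\<^sup>2) \<noteq> 0 \<and>
        torus_entropy d (\<lambda>\<xi>. (cmod (fourier d f \<xi>))\<^sup>2)
          + (1 / ln 2 - 1) * lattice_entropy d (\<lambda>x. (cmod (f x))\<^sup>2) = 0"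
    using f entropy_const[OF f] assms by (intro exI[of _ f]) (simp add: algebra_simps)
next
  fix f assume f: "supported_in_cube d f \<and> L2_set (\<lambda>x. cmod (f x)) (cube d) = 1 \<and>
        (\<exists>c. \<forall>x\<in>cube d. f x = c)"
  then obtain k where "\<forall>x\<in>cube d. f x = k" by blast
  note entropy_const[OF conjunct1[OF f] conjunct1[OF conjunct2[OF f]] this]
  then show "lattice_entropy d (\<lambda>x. (cmod (f x))\<^sup>2) \<noteq> 0"
    and "torus_entropy d (\<lambda>\<xi>. (cmod (fourier d f \<xi>))\<^sup>2)
          + (1 / ln 2 - 1) * lattice_entropy d (\<lambda>x. (cmod (f x))\<^sup>2) = 0"
    using assms by (simp_all add: algebra_simps)
qed

end
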